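(* Fix $\theta_0\in(0,1)$ and $w_0>0$. For each $\theta\in(0,\theta_0]$ let $(\rho_0^{(\theta)},m_0^{(\theta)})$ be initial data with $\rho_0^{(\theta)}\ge0$ a.e., $(\rho_0^{(\theta)},m_0^{(\theta)}/\rho_0^{(\theta)})\in L^\infty(\mathbb{R})$ and $$\frac{|m_0^{(\theta)}(x)|}{\rho_0^{(\theta)}(x)}+\frac{(\rho_0^{(\theta)}(x))^{\theta}-1}{\theta}\le w_0\qquad\text{for a.e. }x\in\mathbb{R}.$$ Let $(\rho^{(\theta)},m^{(\theta)})$ be a constructed entropy solution of system $(E_\theta)$ with these initial data and let $D^{(\theta)}(t,x;s)$ be its dissipation measure (in the sense of the context). Then the total variation of $D^{(\theta)}$ is locally uniformly bounded with respect to $\theta\in(0,\theta_0]$: for any compact set $K\subset\mathbb{R}^2_+$ there exists $C(w_0;K)>0$, independent of $\theta\in(0,\theta_0]$, such that $$\int_{\mathbb{R}}|D^{(\theta)}(\cdot,\cdot;s)|(K)\,ds\le C(w_0;K)\qquad\text{for all }\theta\in(0,\theta_0],$$ and $\operatorname{supp}D^{(\theta)}(t,x;\cdot)\subset[-w_0,w_0]$.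
   Context: Notation: $\mathbb{R}^2_+=(0,\infty)\times\mathbb{R}$ with points $(t,x)$; $[y]_+=\max(0,y)$. For $\theta>0$, system $(E_\theta)$ is the isentropic Euler system $$\partial_t\rho+\partial_x m=0,\qquad \partial_t m+\partial_x\Big(\frac{m^2}{\rho}+p^{(\theta)}(\rho)\Big)=0,\qquad p^{(\theta)}(\rho)=\frac{\rho^{2\theta+1}}{2\theta+1}.$$ Here $\rho\ge0$ and $m=0$ a.e. on the vacuum set $\{\rho=0\}$. Convention: $m/\rho:=0$, $m^2/\rho:=0$, $m^3/\rho^2:=0$ where $\rho=0$. Mechanical energy pair: $$\eta_*^{(\theta)}=\frac12\frac{m^2}{\rho}+\rho e^{(\theta)}(\rho),\quad q_*^{(\theta)}=\frac12\frac{m^3}{\rho^2}+m\frac{d(\rho e^{(\theta)}(\rho))}{d\rho},\quad e^{(\theta)}(\rho)=\int_1^\rho\frac{p^{(\theta)}(\tau)}{\tau^2}\,d\tau .$$ Entropy solution: $U=(\rho,m)\in L^\infty(\mathbb{R}^2_+)$ is an entropy solution of $(E_\theta)$ with initial data $U_0=(\rho_0,m_0)\in L^\infty(\mathbb{R})$ if, with $F^{(\theta)}(U)=(m,\frac{m^2}{\rho}+p^{(\theta)}(\rho))$, for all $\phi\in C_c^\infty([0,\infty)\times\mathbb{R})$, $$\int_{\mathbb{R}^2_+}\big(U\partial_t\phi+F^{(\theta)}(U)\partial_x\phi\big)dx\,dt+\int_{\mathbb{R}}U_0(x)\phi(0,x)\,dx=0,$$ and for all such $\phi\ge0$, $$\int_{\mathbb{R}^2_+}\big(\eta_*^{(\theta)}(U)\partial_t\phi+q_*^{(\theta)}(U)\partial_x\phi\big)dx\,dt+\int_{\mathbb{R}}\eta_*^{(\theta)}(U_0(x))\phi(0,x)\,dx\ge0.$$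 For $\theta\in(0,1)$ the weak entropy kernel is $$\chi^{(\theta)}(\rho;v)=a_\theta\Big[\big(\tfrac{\rho^\theta}{\theta}\big)^2-v^2\Big]_+^{\frac{1-\theta}{2\theta}},\qquad a_\theta=\theta^{1/\theta}\Big(\int_{-1}^1(1-\tau^2)^{\frac{1-\theta}{2\theta}}d\tau\Big)^{-1}.$$ Constructed entropy solution and dissipation measure: a constructed entropy solution of $(E_\theta)$ with initial data $(\rho_0,m_0)$, together with its dissipation measure, is an entropy solution $(\rho,m)$ with these initial data and a nonpositive Radon measure $D^{(\theta)}(t,x;s)$ on $\mathbb{R}^2_+\times\mathbb{R}$, with finite mass on $K\times\mathbb{R}$ for every compact $K\subset\mathbb{R}^2_+$, such that: (a) $\chi^{(\theta)}=\chi^{(\theta)}(\rho(t,x);s-\frac{m(t,x)}{\rho(t,x)})$ satisfies, in the sense of distributions in $(t,x,s)\in\mathbb{R}^2_+\times\mathbb{R}$, $$\partial_t\chi^{(\theta)}+\partial_x\Big(\big(\theta s+(1-\theta)\tfrac m\rho\big)\chi^{(\theta)}\Big)=\partial_{ss}D^{(\theta)};$$ (b) for a.e. $(t,x)\in\mathbb{R}^2_+$, $$\frac{|m(t,x)|}{\rho(t,x)}+\frac{\rho(t,x)^\theta-1}{\theta}\le w_0^{(\theta)}:=\operatorname*{ess\,sup}_{y\in\mathbb{R}}\Big(\frac{|m_0(y)|}{\rho_0(y)}+\frac{\rho_0(y)^\theta-1}{\theta}\Big);$$ (c) $\operatorname{supp}D^{(\theta)}(t,x;\cdot)\subset[-w_0^{(\theta)},w_0^{(\theta)}]$,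 meaning that $D^{(\theta)}$ vanishes on $\mathbb{R}^2_+\times(\mathbb{R}\setminus[-w_0^{(\theta)},w_0^{(\theta)}])$. The notation $\int_{\mathbb{R}}|D^{(\theta)}(\cdot,\cdot;s)|(K)\,ds$ stands for the total variation $|D^{(\theta)}|(K\times\mathbb{R})$. *)

theory Defs
  imports "HOL-Analysis.Analysis" "HOL-Probability.Essential_Supremum"
begin

section \<open>Domain, bounded functions and test functions\<close>

text \<open>
  Points of the open half plane are pairs \<open>(t, x)\<close>; points of its product with the kinetic variable
  are \<open>((t, x), s)\<close>. Elements of \<open>L\<^sup>\<infinity>\<close> are given by Borel representatives; none of the notions
  below depends on the representative.

  The conventions \<open>m/\<rho> = m\<^sup>2/\<rho> = m\<^sup>3/\<rho>\<^sup>2 = 0\<close> at \<open>\<rho> = 0\<close> are those of division in HOL.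
\<close>

definition half_plane :: "(real \<times> real) set" where
  "half_plane = {0<..} \<times> UNIV"

definition half_plane_measure :: "(real \<times> real) measure" where
  "half_plane_measure = restrict_space lborel half_plane"

definition kinetic_measure :: "((real \<times> real) \<times> real) measure" where
  "kinetic_measure = restrict_space lborel (half_plane \<times> UNIV)"

definition Linf :: "'a measure \<Rightarrow> ('a \<Rightarrow> real) \<Rightarrow> bool" where
  "Linf M f \<longleftrightarrow> f \<in> borel_measurable M \<and> esssup M (\<lambda>x. ereal \<bar>f x\<bar>) < \<infinity>"

definition dir_deriv :: "'a \<Rightarrow> ('a::real_normed_vector \<Rightarrow> real) \<Rightarrow> 'a \<Rightarrow> real" where
  "dir_deriv v f z = frechet_derivative f (at z) v"

primrec Ck :: "nat \<Rightarrow> ('a::real_normed_vector \<Rightarrow> real) \<Rightarrow> bool" where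
  "Ck 0 f \<longleftrightarrow> continuous_on UNIV f"
| "Ck (Suc k) f \<longleftrightarrow> (\<forall>z. f differentiable (at z)) \<and> (\<forall>v. Ck k (dir_deriv v f))"

text \<open>
  \<open>test_function \<Omega>\<close> is \<open>C\<^sub>c\<^sup>\<infinity>(\<Omega>)\<close> for open \<open>\<Omega>\<close>. The space \<open>C\<^sub>c\<^sup>\<infinity>([0,\<infinity>) \<times> \<real>)\<close> is used through
  \<open>test_function UNIV\<close>: its members are the restrictions to \<open>t \<ge> 0\<close> of smooth compactly supported
  functions on the plane, and only values with \<open>t \<ge> 0\<close> are ever evaluated.
\<close>

definition test_function :: "'a set \<Rightarrow> ('a::real_normed_vector \<Rightarrow> real) \<Rightarrow> bool" where
  "test_function \<Omega> \<phi> \<longleftrightarrow> (\<forall>k. Ck k \<phi>) \<and>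
     compact (closure {z. \<phi> z \<noteq> 0}) \<and> closure {z. \<phi> z \<noteq> 0} \<subseteq> \<Omega>"

section \<open>The isentropic Euler system and its entropy solutions\<close>

definition pressure :: "real \<Rightarrow> real \<Rightarrow> real" where
  "pressure \<theta> \<rho> = \<rho> powr (2 * \<theta> + 1) / (2 * \<theta> + 1)"

definition int_energy :: "real \<Rightarrow> real \<Rightarrow> real" where
  "int_energy \<theta> \<rho> = (LBINT \<tau>=ereal 1..ereal \<rho>. pressure \<theta> \<tau> / \<tau>\<^sup>2)"

definition mech_energy :: "real \<Rightarrow> real \<Rightarrow> real \<Rightarrow> real" where
  "mech_energy \<theta> \<rho> m = 1/2 * (m\<^sup>2 / \<rho>) + \<rho> * int_energy \<theta> \<rho>"

definition mech_energy_flux :: "real \<Rightarrow> real \<Rightarrow> real \<Rightarrow> real" where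
  "mech_energy_flux \<theta> \<rho> m =
     1/2 * (m ^ 3 / \<rho>\<^sup>2) + m * deriv (\<lambda>r. r * int_energy \<theta> r) \<rho>"

text \<open>
  Weak form of \<open>\<partial>\<^sub>t u + \<partial>\<^sub>x f\<close> with initial value \<open>u\<^sub>0\<close>, tested against \<open>\<phi>\<close>. Since the Bochner
  integral of a non-integrable function is 0, the existence of the integrals is recorded separately.
\<close>

definition weak_form ::
  "(real \<times> real \<Rightarrow> real) \<Rightarrow> (real \<times> real \<Rightarrow> real) \<Rightarrow> (real \<Rightarrow> real) \<Rightarrow> (real \<times> real \<Rightarrow> real) \<Rightarrow> real"
where
  "weak_form u f u0 \<phi> =
     (LINT z|half_plane_measure. u z * dir_deriv (1, 0) \<phi> z + f z * dir_deriv (0, 1) \<phi> z)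
     + (LINT x|lborel. u0 x * \<phi> (0, x))"

definition weak_form_exists ::
  "(real \<times> real \<Rightarrow> real) \<Rightarrow> (real \<times> real \<Rightarrow> real) \<Rightarrow> (real \<Rightarrow> real) \<Rightarrow> (real \<times> real \<Rightarrow> real) \<Rightarrow> bool"
where
  "weak_form_exists u f u0 \<phi> \<longleftrightarrow>
     integrable half_plane_measure (\<lambda>z. u z * dir_deriv (1, 0) \<phi> z + f z * dir_deriv (0, 1) \<phi> z)
     \<and> integrable lborel (\<lambda>x. u0 x * \<phi> (0, x))"

definition entropy_solution ::
  "real \<Rightarrow> (real \<Rightarrow> real) \<Rightarrow> (real \<Rightarrow> real) \<Rightarrow> (real \<times> real \<Rightarrow> real) \<Rightarrow> (real \<times> real \<Rightarrow> real) \<Rightarrow> bool"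
where
  "entropy_solution \<theta> \<rho>0 m0 \<rho> m \<longleftrightarrow>
     Linf half_plane_measure \<rho> \<and> Linf half_plane_measure m \<and> Linf lborel \<rho>0 \<and> Linf lborel m0 \<and>
     (AE z in half_plane_measure. \<rho> z \<ge> 0 \<and> (\<rho> z = 0 \<longrightarrow> m z = 0)) \<and>
     (\<forall>\<phi>. test_function UNIV \<phi> \<longrightarrow>
        weak_form_exists \<rho> m \<rho>0 \<phi> \<and> weak_form \<rho> m \<rho>0 \<phi> = 0 \<and>
        weak_form_exists m (\<lambda>z. (m z)\<^sup>2 / \<rho> z + pressure \<theta> (\<rho> z)) m0 \<phi> \<and>
        weak_form m (\<lambda>z. (m z)\<^sup>2 / \<rho> z + pressure \<theta> (\<rho> z)) m0 \<phi> = 0) \<and>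
     (\<forall>\<phi>. test_function UNIV \<phi> \<and> (\<forall>t\<ge>0. \<forall>x. \<phi> (t, x) \<ge> 0) \<longrightarrow>
        weak_form_exists (\<lambda>z. mech_energy \<theta> (\<rho> z) (m z)) (\<lambda>z. mech_energy_flux \<theta> (\<rho> z) (m z))
          (\<lambda>x. mech_energy \<theta> (\<rho>0 x) (m0 x)) \<phi> \<and>
        weak_form (\<lambda>z. mech_energy \<theta> (\<rho> z) (m z)) (\<lambda>z. mech_energy_flux \<theta> (\<rho> z) (m z))
          (\<lambda>x. mech_energy \<theta> (\<rho>0 x) (m0 x)) \<phi> \<ge> 0)"

section \<open>Constructed entropy solutions and their dissipation measures\<close>

definition kernel_const :: "real \<Rightarrow> real" where
  "kernel_const \<theta> = \<theta> powr (1 / \<theta>) *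
     inverse (LBINT \<tau>=ereal (-1)..ereal 1. (1 - \<tau>\<^sup>2) powr ((1 - \<theta>) / (2 * \<theta>)))"

definition entropy_kernel :: "real \<Rightarrow> real \<Rightarrow> real \<Rightarrow> real" where
  "entropy_kernel \<theta> \<rho> v =
     kernel_const \<theta> * (max 0 ((\<rho> powr \<theta> / \<theta>)\<^sup>2 - v\<^sup>2)) powr ((1 - \<theta>) / (2 * \<theta>))"

definition riemann_bound :: "real \<Rightarrow> real \<Rightarrow> real \<Rightarrow> real" where
  "riemann_bound \<theta> \<rho> m = \<bar>m\<bar> / \<rho> + (\<rho> powr \<theta> - 1) / \<theta>"

definition data_bound :: "real \<Rightarrow> (real \<Rightarrow> real) \<Rightarrow> (real \<Rightarrow> real) \<Rightarrow> ereal" where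
  "data_bound \<theta> \<rho>0 m0 = esssup lborel (\<lambda>y. ereal (riemann_bound \<theta> (\<rho>0 y) (m0 y)))"

text \<open>
  A nonpositive Radon measure \<open>D\<close> on \<open>half_plane \<times> \<real>\<close> is represented by the nonnegative measure
  \<open>\<mu> = - D\<close>, which is also its total variation measure \<open>\<bar>D\<bar>\<close>. Finiteness on the sets \<open>K \<times> \<real>\<close>
  implies finiteness on compact sets, hence that \<open>\<mu>\<close> is Radon.
\<close>

definition neg_of_nonpos_radon :: "((real \<times> real) \<times> real) measure \<Rightarrow> bool" where
  "neg_of_nonpos_radon \<mu> \<longleftrightarrow>
     space \<mu> = half_plane \<times> UNIV \<and>
     sets \<mu> = sets (restrict_space borel (half_plane \<times> UNIV)) \<and>
     (\<forall>K. compact K \<and> K \<subseteq> half_plane \<longrightarrow> emeasure \<mu> (K \<times> UNIV) < \<infinity>)"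

text \<open>
  The equation \<open>\<partial>\<^sub>t \<chi> + \<partial>\<^sub>x ((\<theta> s + (1 - \<theta>) m/\<rho>) \<chi>) = \<partial>\<^sub>s\<^sub>s D\<close> in the sense of distributions, with
  \<open>D = - \<mu>\<close>: both sides are paired with \<open>\<psi>\<close>.
\<close>

definition kinetic_equation ::
  "real \<Rightarrow> (real \<times> real \<Rightarrow> real) \<Rightarrow> (real \<times> real \<Rightarrow> real) \<Rightarrow> ((real \<times> real) \<times> real) measure \<Rightarrow> bool"
where
  "kinetic_equation \<theta> \<rho> m \<mu> \<longleftrightarrow>
     (\<forall>\<psi>. test_function (half_plane \<times> UNIV) \<psi> \<longrightarrow>
        (let k = (\<lambda>(z, s). entropy_kernel \<theta> (\<rho> z) (s - m z / \<rho> z));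
             F = (\<lambda>(z, s). (\<theta> * s + (1 - \<theta>) * (m z / \<rho> z)) * k (z, s));
             g = (\<lambda>y. k y * dir_deriv ((1, 0), 0) \<psi> y + F y * dir_deriv ((0, 1), 0) \<psi> y)
         in integrable kinetic_measure g \<and>
            - (LINT y|kinetic_measure. g y)
              = - (LINT y|\<mu>. dir_deriv ((0, 0), 1) (dir_deriv ((0, 0), 1) \<psi>) y)))"

definition constructed_entropy_solution ::
  "real \<Rightarrow> (real \<Rightarrow> real) \<Rightarrow> (real \<Rightarrow> real) \<Rightarrow> (real \<times> real \<Rightarrow> real) \<Rightarrow> (real \<times> real \<Rightarrow> real)
     \<Rightarrow> ((real \<times> real) \<times> real) measure \<Rightarrow> bool"
where
  "constructed_entropy_solution \<theta> \<rho>0 m0 \<rho> m \<mu> \<longleftrightarrow>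
     entropy_solution \<theta> \<rho>0 m0 \<rho> m \<and>
     neg_of_nonpos_radon \<mu> \<and>
     kinetic_equation \<theta> \<rho> m \<mu> \<and>
     (AE z in half_plane_measure. ereal (riemann_bound \<theta> (\<rho> z) (m z)) \<le> data_bound \<theta> \<rho>0 m0) \<and>
     emeasure \<mu> (half_plane \<times>
       (UNIV - {s. - data_bound \<theta> \<rho>0 m0 \<le> ereal s \<and> ereal s \<le> data_bound \<theta> \<rho>0 m0})) = 0"

end

theory Submission
  imports Defs
begin

text \<open>
  Test the kinetic equation against \<open>\<psi> (z, s) = \<phi> z * h s\<close>, with \<open>h\<close> smooth, compactly supported and
  convex on \<open>[-w, w]\<close>, and \<open>\<psi>\<close> not depending on \<open>\<theta>\<close>. The dissipation measure lives on
  \<open>\<bar>s\<bar> \<le> w\<close>, so if \<open>\<psi>\<^sub>s\<^sub>s \<ge> 1\<close> on \<open>K \<times> [-w, w]\<close> and \<open>\<psi>\<^sub>s\<^sub>s \<ge> 0\<close> for \<open>\<bar>s\<bar> \<le> w\<close>, the mass of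
  \<open>K \<times> \<real>\<close> is at most \<open>\<integral>\<integral> \<chi> (\<psi>\<^sub>t + (\<theta> s + (1 - \<theta>) u) \<psi>\<^sub>x) ds dz\<close> with \<open>u = m/\<rho>\<close>. Although \<open>\<chi>\<close>
  spreads over a velocity range of order \<open>1/\<theta>\<close>, its total mass \<open>\<integral> \<chi> ds\<close> is \<open>\<rho>\<close>; as \<open>h\<close> is bounded with
  fixed support, only \<open>\<rho>\<close> and \<open>\<rho> \<bar>u\<bar>\<close> enter. The invariant region gives
  \<open>\<bar>u\<bar> + ln \<rho> \<le> w\<close> for every \<open>\<theta>\<close>, whence \<open>\<rho> \<le> exp w\<close> and \<open>\<rho> \<bar>u\<bar> \<le> w exp w + 1\<close>.
\<close>

section \<open>Calculus of directional derivatives and of the classes \<open>Ck\<close>\<close>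

lemma dir_deriv_eqI:
  assumes "(f has_derivative f') (at z)"
  shows "dir_deriv v f z = f' v"
  using assms frechet_derivative_at[OF assms] by (simp add: dir_deriv_def)

text \<open>By the chain rule along r -> z + r v. This lets derivatives of a test function in the
  kinetic variable be found by one-variable calculus once joint differentiability is known.\<close>

lemma dir_deriv_along_line:
  assumes "f differentiable (at z)"
    and "((\<lambda>r. f (z + r *\<^sub>R v)) has_real_derivative D) (at 0)"
  shows "dir_deriv v f z = D"
proof -
  obtain f' where f': "(f has_derivative f') (at z)"
    using assms(1) by (auto simp: differentiable_def)
  have "((\<lambda>r. z + r *\<^sub>R v) has_derivative (\<lambda>r. r *\<^sub>R v)) (at 0)"
    by (auto intro!: derivative_eq_intros)
  then have "((\<lambda>r. f (z + r *\<^sub>R v)) has_derivative (\<lambda>r. f' (r *\<^sub>R v))) (at 0)"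
    using has_derivative_compose[of "\<lambda>r. z + r *\<^sub>R v" _ 0 UNIV f f'] f' by simp
  moreover have "f' (r *\<^sub>R v) = f' v * r" for r
    using f' by (simp add: has_derivative_linear linear_cmul)
  ultimately have "((\<lambda>r. f (z + r *\<^sub>R v)) has_real_derivative f' v) (at 0)"
    by (simp add: has_field_derivative_def mult_commute_abs)
  with assms(2) f' show ?thesis
    by (metis DERIV_unique dir_deriv_eqI)
qed

lemma Ck_imp_continuous:
  assumes "Ck k f"
  shows "continuous_on UNIV f"
  using assms
  by (cases k) (auto intro!: differentiable_imp_continuous_on simp: differentiable_on_def)

lemma Ck_Suc_imp_Ck: "Ck (Suc k) f \<Longrightarrow> Ck k f"
proof (induction k arbitrary: f)
  case 0
  then show ?case using Ck_imp_continuous[of 1 f] by simp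
next
  case (Suc k)
  then show ?case by (metis Ck.simps(2))
qed

lemma Ck_cmult: "Ck k f \<Longrightarrow> Ck k (\<lambda>z. c * f z)"
proof (induction k arbitrary: f)
  case 0
  then show ?case by (auto intro!: continuous_intros)
next
  case (Suc k)
  have "dir_deriv v (\<lambda>z. c * f z) = (\<lambda>z. c * dir_deriv v f z)" for v
  proof
    fix z
    have "(f has_derivative frechet_derivative f (at z)) (at z)"
      using Suc.prems frechet_derivative_works by auto
    from has_derivative_mult_right[OF this, of c]
    show "dir_deriv v (\<lambda>z. c * f z) z = c * dir_deriv v f z"
      by (subst dir_deriv_eqI) (auto simp: dir_deriv_def)
  qed
  then show ?case using Suc by (simp add: differentiable_mult)
qed

lemma Ck_add: "Ck k f \<Longrightarrow> Ck k g \<Longrightarrow> Ck k (\<lambda>z. f z + g z)"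
proof (induction k arbitrary: f g)
  case 0
  then show ?case by (auto intro!: continuous_intros)
next
  case (Suc k)
  have "dir_deriv v (\<lambda>z. f z + g z) = (\<lambda>z. dir_deriv v f z + dir_deriv v g z)" for v
  proof
    fix z
    have "(f has_derivative frechet_derivative f (at z)) (at z)"
         "(g has_derivative frechet_derivative g (at z)) (at z)"
      using Suc.prems by (simp_all add: frechet_derivative_works[symmetric])
    from has_derivative_add[OF this]
    show "dir_deriv v (\<lambda>z. f z + g z) z = dir_deriv v f z + dir_deriv v g z"
      by (subst dir_deriv_eqI) (auto simp: dir_deriv_def)
  qed
  then show ?case using Suc by auto
qed

text \<open>Each term of the Leibniz rule keeps one factor undifferentiated. That factor has one
  derivative too many for the induction hypothesis, so it is first lowered with
  \<open>Ck_Suc_imp_Ck\<close>.\<close>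

lemma Ck_mult: "Ck k f \<Longrightarrow> Ck k g \<Longrightarrow> Ck k (\<lambda>z. f z * g z)"
proof (induction k arbitrary: f g)
  case 0
  then show ?case by (auto intro!: continuous_intros)
next
  case (Suc k)
  have *: "dir_deriv v (\<lambda>z. f z * g z) = (\<lambda>z. f z * dir_deriv v g z + dir_deriv v f z * g z)" for v
  proof
    fix z
    have "(f has_derivative frechet_derivative f (at z)) (at z)"
         "(g has_derivative frechet_derivative g (at z)) (at z)"
      using Suc.prems by (simp_all add: frechet_derivative_works[symmetric])
    from has_derivative_mult[OF this]
    show "dir_deriv v (\<lambda>z. f z * g z) z = f z * dir_deriv v g z + dir_deriv v f z * g z"
      by (subst dir_deriv_eqI) (auto simp: dir_deriv_def)
  qed
  have "Ck k f" "Ck k g"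
    using Suc.prems[THEN Ck_Suc_imp_Ck] .
  moreover have "Ck k (dir_deriv v f)" "Ck k (dir_deriv v g)" for v
    using Suc.prems by simp_all
  ultimately have "Ck k (\<lambda>z. f z * dir_deriv v g z + dir_deriv v f z * g z)" for v
    by (intro Ck_add Suc.IH)
  then show ?case
    using Suc.prems by (simp add: * differentiable_mult)
qed

section \<open>Smooth functions that are flat at 0\<close>

definition flat :: "real poly \<Rightarrow> real \<Rightarrow> real" where
  "flat p x = (if x > 0 then poly p (1 / x) * exp (- (1 / x)) else 0)"

text \<open>With y = 1/x one has d/dx = - y^2 d/dy, which turns p(y) exp(-y) into y^2 (p(y) - p'(y))
  exp(-y). The family \<open>flat p\<close> is thus closed under differentiation, and its smoothness
  becomes an induction on the order with p arbitrary.\<close>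

definition flat_step :: "real poly \<Rightarrow> real poly" where
  "flat_step p = [:0, 0, 1:] * (p - pderiv p)"

lemma poly_times_exp_minus_tendsto_0:
  fixes p :: "real poly"
  shows "((\<lambda>y. poly p y * exp (- y)) \<longlongrightarrow> 0) at_top"
proof -
  have "((\<lambda>y. \<Sum>i\<le>degree p. coeff p i * (y ^ i / exp y)) \<longlongrightarrow> 0) at_top"
    by (intro tendsto_null_sum tendsto_mult_right_zero tendsto_power_div_exp_0)
  then show ?thesis
    by (simp add: poly_altdef sum_distrib_right exp_minus divide_inverse mult.assoc)
qed

lemma flat_has_derivative_pos:
  assumes "x > 0"
  shows "(flat p has_real_derivative flat (flat_step p) x) (at x)"
proof -
  have q: "poly (flat_step p) y = y\<^sup>2 * (poly p y - poly (pderiv p) y)" for y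
    by (simp add: flat_step_def power2_eq_square)
  have ev: "eventually (\<lambda>y. flat p y = poly p (1 / y) * exp (- (1 / y))) (nhds x)"
    using eventually_nhds_in_open[of "{0<..}" x] assms(1)
    by (auto elim!: eventually_mono simp: flat_def)
  have i: "((\<lambda>y. 1 / y) has_real_derivative - (1 / x\<^sup>2)) (at x)"
    using assms(1) by (auto intro!: derivative_eq_intros simp: power2_eq_square)
  have "((\<lambda>y. poly p (1 / y) * exp (- (1 / y))) has_real_derivative
      poly (pderiv p) (1 / x) * - (1 / x\<^sup>2) * exp (- (1 / x))
      + exp (- (1 / x)) * - (- (1 / x\<^sup>2)) * poly p (1 / x)) (at x)"
    by (intro DERIV_mult DERIV_chain2[OF poly_DERIV i] DERIV_chain2[OF DERIV_exp] DERIV_minus i)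
  also have "poly (pderiv p) (1 / x) * - (1 / x\<^sup>2) * exp (- (1 / x))
      + exp (- (1 / x)) * - (- (1 / x\<^sup>2)) * poly p (1 / x) = flat (flat_step p) x"
    using assms(1) by (simp only: flat_def q if_True power_one_over) algebra
  finally show ?thesis
    using DERIV_cong_ev[OF refl ev refl] by simp
qed

lemma flat_has_derivative_0: "(flat p has_real_derivative 0) (at 0)"
proof -
  have "((\<lambda>h. (flat p (0 + h) - flat p 0) / h) \<longlongrightarrow> 0) (at_right 0)"
  proof -
    \<comment> \<open>With y = 1/h the right difference quotient at 0 is y p(y) exp(-y), and y tends
      to infinity; the quotient's 1/h is the factor \<open>[:0, 1:]\<close>.\<close>
    have "((\<lambda>h. poly ([:0, 1:] * p) (1 / h) * exp (- (1 / h))) \<longlongrightarrow> 0) (at_right 0)"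
      using filterlim_compose[OF poly_times_exp_minus_tendsto_0[of "[:0, 1:] * p"]
          filterlim_inverse_at_top_right] by (simp add: inverse_eq_divide)
    moreover have "eventually (\<lambda>h. poly ([:0, 1:] * p) (1 / h) * exp (- (1 / h))
        = (flat p (0 + h) - flat p 0) / h) (at_right 0)"
      by (simp add: eventually_at_filter flat_def)
    ultimately show ?thesis
      by (rule Lim_transform_eventually)
  qed
  moreover have "((\<lambda>h. (flat p (0 + h) - flat p 0) / h) \<longlongrightarrow> 0) (at_left 0)"
    by (rule Lim_transform_eventually[OF tendsto_const])
       (simp add: eventually_at_filter flat_def)
  ultimately show ?thesis
    by (simp add: DERIV_def filterlim_split_at)
qed

lemma flat_has_derivative: "(flat p has_real_derivative flat (flat_step p) x) (at x)"
proof -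
  consider "x > 0" | "x < 0" | "x = 0" by linarith
  then show ?thesis
  proof cases
    case 1
    then show ?thesis by (rule flat_has_derivative_pos)
  next
    case 2
    have ev: "eventually (\<lambda>y. flat p y = 0) (nhds x)"
      using eventually_nhds_in_open[of "{..<0}" x] 2
      by (auto elim!: eventually_mono simp: flat_def)
    have "flat (flat_step p) x = 0" using 2 by (simp add: flat_def)
    then show ?thesis
      using DERIV_cong_ev[OF refl ev refl] by simp
  next
    case 3
    then have "flat (flat_step p) x = 0" by (simp add: flat_def)
    then show ?thesis using flat_has_derivative_0 3 by simp
  qed
qed

lemma continuous_on_flat: "continuous_on A (flat p)"
  by (meson DERIV_isCont flat_has_derivative continuous_at_imp_continuous_on)

text \<open>The derivative in direction v is the constant \<open>L v\<close> times a function of the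
  same form, with \<open>flat_step p\<close> in place of p. Affine arguments suffice for every
  factor of the cutoffs below.\<close>

lemma Ck_flat_affine:
  assumes L: "bounded_linear L"
  shows "Ck k (\<lambda>z. flat p (L z + c))"
proof (induction k arbitrary: p)
  case 0
  have "continuous_on UNIV (flat p)" by (rule continuous_on_flat)
  moreover have "continuous_on UNIV (\<lambda>z. L z + c)"
    by (intro continuous_on_add continuous_on_const linear_continuous_on L)
  ultimately show ?case
    using continuous_on_compose2[of UNIV "flat p" UNIV "\<lambda>z. L z + c"] by simp
next
  case (Suc k)
  let ?q = "flat_step p"
  have d: "((\<lambda>z. flat p (L z + c)) has_derivative (\<lambda>v. flat ?q (L z + c) * L v)) (at z)" for z
  proof -
    have "((\<lambda>z. L z + c) has_derivative (\<lambda>v. L v + 0)) (at z)"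
      by (intro has_derivative_add has_derivative_const bounded_linear_imp_has_derivative L)
    then show ?thesis
      using has_derivative_compose[of "\<lambda>z. L z + c" L z UNIV "flat p"] flat_has_derivative[of p "L z + c"]
      by (simp add: has_field_derivative_def)
  qed
  have "dir_deriv v (\<lambda>z. flat p (L z + c)) = (\<lambda>z. L v * flat ?q (L z + c))" for v
    using dir_deriv_eqI[OF d] by (auto simp: mult.commute)
  moreover have "\<forall>z. (\<lambda>z. flat p (L z + c)) differentiable (at z)"
    using d by (auto simp: differentiable_def)
  ultimately show ?case
    using Ck_cmult[OF Suc] by simp
qed

section \<open>Test functions of product form\<close>

lemma dir_deriv_snd:
  fixes \<phi> :: "'a::real_normed_vector \<Rightarrow> real"
  assumes "\<And>y. f differentiable (at y)"
    and "\<And>z s. f (z, s) = \<phi> z * h s"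
    and "\<And>s. (h has_real_derivative h' s) (at s)"
  shows "dir_deriv (0, 1) f (z, s) = \<phi> z * h' s"
\<comment> \<open>On the line through (z, s) in the kinetic direction the factor
  \<open>\<phi> z\<close> is constant, so \<phi> itself is never differentiated.\<close>
proof (rule dir_deriv_along_line[OF assms(1)])
  have "((\<lambda>r. h (s + r)) has_real_derivative h' s) (at 0)"
    using assms(3)[of s] DERIV_shift[of h "h' s" 0 s] by (simp add: add.commute[of s])
  from DERIV_cmult[OF this, of "\<phi> z"]
  show "((\<lambda>r. f ((z, s) + r *\<^sub>R (0, 1))) has_real_derivative \<phi> z * h' s) (at 0)"
    by (simp add: assms(2))
qed

lemma test_functionI:
  fixes \<phi> :: "'a::{real_normed_vector, heine_borel} \<Rightarrow> real"
  assumes "\<And>k. Ck k \<phi>" "compact S" "{z. \<phi> z \<noteq> 0} \<subseteq> S" "S \<subseteq> \<Omega>"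
  shows "test_function \<Omega> \<phi>"
proof -
  have "closure {z. \<phi> z \<noteq> 0} \<subseteq> S"
    using assms(2,3) by (simp add: closure_minimal compact_imp_closed)
  moreover have "bounded {z. \<phi> z \<noteq> 0}"
    using bounded_subset[OF compact_imp_bounded[OF assms(2)] assms(3)] .
  then have "compact (closure {z. \<phi> z \<noteq> 0})"
    using compact_closure by blast
  ultimately show ?thesis
    unfolding test_function_def using assms(1,4) by blast
qed

section \<open>A bump function of one variable\<close>

lemma flat_nonneg: "0 \<le> flat [:1:] x"
  and flat_pos: "0 < x \<Longrightarrow> 0 < flat [:1:] x"
  and flat_nonpos_eq_0: "x \<le> 0 \<Longrightarrow> flat p x = 0"
  by (simp_all add: flat_def)

text \<open>For |r| < 1 this is exp(-2 / (1 - r^2)), and it is 0 elsewhere. It is used with a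
  negative factor: the second derivative at 0 is negative, so \<open>- bump\<close> is convex near
  0, and a dilation spreads that neighbourhood over the velocity interval.\<close>

definition bump :: "real \<Rightarrow> real" where
  "bump r = flat [:1:] (1 + r) * flat [:1:] (1 - r)"

definition bump' :: "real \<Rightarrow> real" where
  "bump' r = flat (flat_step [:1:]) (1 + r) * flat [:1:] (1 - r)
     - flat [:1:] (1 + r) * flat (flat_step [:1:]) (1 - r)"

definition bump'' :: "real \<Rightarrow> real" where
  "bump'' r = flat (flat_step (flat_step [:1:])) (1 + r) * flat [:1:] (1 - r)
     - 2 * (flat (flat_step [:1:]) (1 + r) * flat (flat_step [:1:]) (1 - r))
     + flat [:1:] (1 + r) * flat (flat_step (flat_step [:1:])) (1 - r)"

lemma flat_plus_has_derivative:
    "((\<lambda>r. flat p (1 + r)) has_real_derivative flat (flat_step p) (1 + r)) (at r)"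
  and flat_minus_has_derivative:
    "((\<lambda>r. flat p (1 - r)) has_real_derivative - flat (flat_step p) (1 - r)) (at r)"
proof -
  have "((\<lambda>r::real. 1 + r) has_real_derivative 1) (at r)"
    "((\<lambda>r::real. 1 - r) has_real_derivative -1) (at r)"
    by (auto intro!: derivative_eq_intros)
  then show "((\<lambda>r. flat p (1 + r)) has_real_derivative flat (flat_step p) (1 + r)) (at r)"
    "((\<lambda>r. flat p (1 - r)) has_real_derivative - flat (flat_step p) (1 - r)) (at r)"
    using DERIV_chain2[OF flat_has_derivative] by fastforce+
qed

lemma bump_has_derivative: "(bump has_real_derivative bump' r) (at r)"
  using DERIV_mult[OF flat_plus_has_derivative[of "[:1:]" r] flat_minus_has_derivative[of "[:1:]" r]]
  by (simp add: bump_def[abs_def] bump'_def mult.commute)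

lemma bump'_has_derivative: "(bump' has_real_derivative bump'' r) (at r)"
proof -
  have "bump'' r = flat (flat_step (flat_step [:1:])) (1 + r) * flat [:1:] (1 - r)
      + - flat (flat_step [:1:]) (1 - r) * flat (flat_step [:1:]) (1 + r)
      - (flat (flat_step [:1:]) (1 + r) * flat (flat_step [:1:]) (1 - r)
      + - flat (flat_step (flat_step [:1:])) (1 - r) * flat [:1:] (1 + r))"
    unfolding bump''_def by algebra
  then show ?thesis
    using DERIV_diff[OF
        DERIV_mult[OF flat_plus_has_derivative[of "flat_step [:1:]" r] flat_minus_has_derivative[of "[:1:]" r]]
        DERIV_mult[OF flat_plus_has_derivative[of "[:1:]" r] flat_minus_has_derivative[of "flat_step [:1:]" r]]]
    unfolding bump'_def[abs_def] by (simp only:)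
qed

lemma bump''_0_neg: "bump'' 0 < 0"
proof -
  have "bump'' 0 = - 4 * (exp (-1) * exp (-1))"
    by (simp add: bump''_def flat_def flat_step_def pderiv_pCons)
  then show ?thesis
    by simp
qed

lemma bump''_neg_near_0:
  obtains r d where "0 < r" "0 < d" "\<And>x. \<bar>x\<bar> \<le> r \<Longrightarrow> bump'' x \<le> - d"
proof -
  have "continuous_on UNIV bump''"
    unfolding bump''_def[abs_def]
    by (intro continuous_intros continuous_on_compose2[OF continuous_on_flat[of UNIV]]) auto
  then have "isCont bump'' 0"
    by (simp add: continuous_on_eq_continuous_at)
  \<comment> \<open>Deviating from the negative value \<open>bump'' 0\<close> by less than half its
    size leaves the other half as the margin d.\<close>
  then obtain e where e: "e > 0" "\<And>x. dist x 0 < e \<Longrightarrow> dist (bump'' x) (bump'' 0) < - bump'' 0 / 2"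
    using bump''_0_neg unfolding continuous_at_eps_delta
    by (metis half_gt_zero neg_0_less_iff_less)
  show thesis
  proof
    show "0 < e / 2" "0 < - bump'' 0 / 2" using e bump''_0_neg by auto
    show "bump'' x \<le> - (- bump'' 0 / 2)" if "\<bar>x\<bar> \<le> e / 2" for x
    proof -
      have "dist x 0 < e" using that e(1) by simp
      from e(2)[OF this] show ?thesis by (auto simp: dist_real_def abs_real_def split: if_splits)
    qed
  qed
qed

section \<open>A cutoff in (t, x) and the test function of the proof\<close>

lemma compact_half_plane_box:
  assumes "compact K" "K \<subseteq> half_plane"
  obtains a T R where "0 < a" "\<And>z. z \<in> K \<Longrightarrow> a < fst z \<and> fst z < T \<and> \<bar>snd z\<bar> < R"
proof (cases "K = {}")
  case True
  then show ?thesis using that[of 1] by simp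
next
  case False
  obtain z0 where z0: "z0 \<in> K" "\<And>z. z \<in> K \<Longrightarrow> fst z0 \<le> fst z"
    using continuous_attains_inf[OF assms(1) False, of fst]
      continuous_on_fst[OF continuous_on_id] by metis
  obtain B where B: "\<And>z. z \<in> K \<Longrightarrow> norm z \<le> B"
    using assms(1) compact_imp_bounded bounded_iff by metis
  have "0 < fst z0" using z0 assms(2) by (auto simp: half_plane_def)
  show ?thesis
  proof (rule that)
    \<comment> \<open>The least time in K is halved so that the lower bound is strict even where
      that time is attained.\<close>
    show "0 < fst z0 / 2" using \<open>0 < fst z0\<close> by simp
  next
    fix z assume "z \<in> K"
    then show "fst z0 / 2 < fst z \<and> fst z < B + 1 \<and> \<bar>snd z\<bar> < B + 1"
      using z0(2)[of z] \<open>0 < fst z0\<close> B[of z] norm_fst_le[of "fst z" "snd z"] norm_snd_le[of "snd z" "fst z"]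
      by (auto simp: abs_real_def split: if_splits)
  qed
qed

text \<open>One flat factor for each side of a rectangle that contains K strictly inside makes
  \<phi> positive on K, and compactness turns this into a bound d. Smoothness is stated for the
  pullback to ((t, x), s), where \<phi> will be multiplied by a function of s.\<close>

lemma plane_cutoff:
  assumes "compact K" "K \<subseteq> half_plane"
  obtains \<phi> S d where "\<And>k. Ck k (\<lambda>y::(real \<times> real) \<times> real. \<phi> (fst y))" "\<And>z. 0 \<le> \<phi> z"
    "compact S" "S \<subseteq> half_plane" "{z. \<phi> z \<noteq> 0} \<subseteq> S"
    "0 < d" "\<And>z. z \<in> K \<Longrightarrow> d \<le> \<phi> z"
proof -
  obtain a T R where box: "0 < a" "\<And>z. z \<in> K \<Longrightarrow> a < fst z \<and> fst z < T \<and> \<bar>snd z\<bar> < R"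
    using compact_half_plane_box[OF assms] by blast
  define \<phi> :: "real \<times> real \<Rightarrow> real" where
    "\<phi> z = flat [:1:] (fst z + - a) * flat [:1:] (- fst z + T)
       * (flat [:1:] (snd z + R) * flat [:1:] (- snd z + R))" for z
  have lin: "bounded_linear (\<lambda>y::(real \<times> real) \<times> real. fst (fst y))"
    "bounded_linear (\<lambda>y::(real \<times> real) \<times> real. - fst (fst y))"
    "bounded_linear (\<lambda>y::(real \<times> real) \<times> real. snd (fst y))"
    "bounded_linear (\<lambda>y::(real \<times> real) \<times> real. - snd (fst y))"
    by (intro bounded_linear_minus bounded_linear_fst_comp bounded_linear_snd_comp bounded_linear_fst)+
  have Ck: "Ck k (\<lambda>y::(real \<times> real) \<times> real. \<phi> (fst y))" for k
    unfolding \<phi>_def by (intro Ck_mult Ck_flat_affine lin)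
  have nonneg: "0 \<le> \<phi> z" for z
    unfolding \<phi>_def by (intro mult_nonneg_nonneg flat_nonneg)
  have supp: "{z. \<phi> z \<noteq> 0} \<subseteq> {a..T} \<times> {- R..R}"
  proof
    fix z assume "z \<in> {z. \<phi> z \<noteq> 0}"
    then have "\<not> fst z + - a \<le> 0" "\<not> - fst z + T \<le> 0" "\<not> snd z + R \<le> 0" "\<not> - snd z + R \<le> 0"
      using flat_nonpos_eq_0 by (auto simp: \<phi>_def)
    then show "z \<in> {a..T} \<times> {- R..R}"
      by (auto simp: mem_Times_iff)
  qed
  have pos: "0 < \<phi> z" if "z \<in> K" for z
    using box(2)[OF that] unfolding \<phi>_def by (intro mult_pos_pos flat_pos) auto
  have "continuous_on K \<phi>"
    unfolding \<phi>_def
    by (intro continuous_intros continuous_on_compose2[OF continuous_on_flat[of UNIV]]) auto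
  obtain d where d: "0 < d" "\<And>z. z \<in> K \<Longrightarrow> d \<le> \<phi> z"
  proof (cases "K = {}")
    case True
    then show ?thesis using that[of 1] by simp
  next
    case False
    then show ?thesis
      using continuous_attains_inf[OF assms(1) False \<open>continuous_on K \<phi>\<close>] pos that by metis
  qed
  show thesis
  proof (rule that[OF Ck nonneg _ _ supp d])
    show "compact ({a..T} \<times> {- R..R})" by (intro compact_Times) auto
    show "{a..T} \<times> {- R..R} \<subseteq> half_plane" using box(1) by (auto simp: half_plane_def)
  qed
qed

text \<open>The function is \<psi>(z, s) = - A \<phi>(z) bump(c s). The dilation c = r / w carries
  [-w, w] into [-r, r], where \<open>bump''\<close> is at most - e. A function with compact support
  in s cannot be convex in s everywhere unless it vanishes, so signs are claimed for |s| <= w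
  only.\<close>

lemma test_function_convex_in_velocity:
  fixes w :: real
  assumes K: "compact K" "K \<subseteq> half_plane" and "0 < w"
  obtains \<psi> where "test_function (half_plane \<times> UNIV) \<psi>"
    "\<And>z s. \<bar>s\<bar> \<le> w \<Longrightarrow> 0 \<le> dir_deriv ((0, 0), 1) (dir_deriv ((0, 0), 1) \<psi>) (z, s)"
    "\<And>z s. z \<in> K \<Longrightarrow> \<bar>s\<bar> \<le> w \<Longrightarrow> 1 \<le> dir_deriv ((0, 0), 1) (dir_deriv ((0, 0), 1) \<psi>) (z, s)"
proof -
  obtain \<phi> S d where Ck: "\<And>k. Ck k (\<lambda>y::(real \<times> real) \<times> real. \<phi> (fst y))" and "\<And>z. 0 \<le> \<phi> z"
    and S: "compact S" "S \<subseteq> half_plane" "{z. \<phi> z \<noteq> 0} \<subseteq> S"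
    and d: "0 < d" "\<And>z. z \<in> K \<Longrightarrow> d \<le> \<phi> z"
    using plane_cutoff[OF K] by metis
  obtain r e where r: "0 < r" "0 < e" "\<And>x. \<bar>x\<bar> \<le> r \<Longrightarrow> bump'' x \<le> - e"
    using bump''_neg_near_0 by metis
  define c where "c = r / w"
  have c: "0 < c" using r \<open>0 < w\<close> by (simp add: c_def)
  \<comment> \<open>Normalised by A c^2 e d = 1: the second s-derivative is then at least \<phi> / d
    for |s| <= w, hence at least 1 over K.\<close>
  define A where "A = 1 / (c\<^sup>2 * e * d)"
  have A: "0 < A" using r c d by (simp add: A_def)
  define \<psi> :: "(real \<times> real) \<times> real \<Rightarrow> real" where
    "\<psi> y = \<phi> (fst y) * (- A * (flat [:1:] (c * snd y + 1) * flat [:1:] (- c * snd y + 1)))" for y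
  have lin: "bounded_linear (\<lambda>y::(real \<times> real) \<times> real. c * snd y)" for c
    by (intro bounded_linear_const_mult bounded_linear_snd)
  have Ck\<psi>: "Ck k \<psi>" for k
    unfolding \<psi>_def[abs_def] by (intro Ck_mult Ck_cmult Ck_flat_affine lin Ck)
  have \<psi>: "\<psi> (z, s) = \<phi> z * (- A * bump (c * s))" for z s
    by (simp add: \<psi>_def bump_def add.commute)
  have scale: "((\<lambda>s. c * s) has_real_derivative c) (at s)" for s
    by (auto intro!: derivative_eq_intros)
  have D0: "((\<lambda>s. - A * bump (c * s)) has_real_derivative - A * (bump' (c * s) * c)) (at s)" for s
    by (intro DERIV_cmult DERIV_chain2[OF bump_has_derivative scale])
  have D1: "((\<lambda>s. - A * (bump' (c * s) * c)) has_real_derivative - A * (bump'' (c * s) * c * c)) (at s)" for s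
    by (intro DERIV_cmult DERIV_cmult_right DERIV_chain2[OF bump'_has_derivative scale])
  have diff: "\<psi> differentiable (at y)" "dir_deriv v \<psi> differentiable (at y)" for v y
    using Ck\<psi>[of "Suc (Suc 0)"] unfolding Ck.simps by blast+
  have d1: "dir_deriv (0, 1) \<psi> (z, s) = \<phi> z * (- A * (bump' (c * s) * c))" for z s
    by (rule dir_deriv_snd[OF diff(1) \<psi> D0])
  have d2: "dir_deriv (0, 1) (dir_deriv (0, 1) \<psi>) (z, s) = \<phi> z * (- A * (bump'' (c * s) * c * c))" for z s
    by (rule dir_deriv_snd[OF diff(2) d1 D1])
  have low: "\<phi> z / d \<le> dir_deriv (0, 1) (dir_deriv (0, 1) \<psi>) (z, s)" if "\<bar>s\<bar> \<le> w" for z s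
  proof -
    have "\<bar>c * s\<bar> \<le> r"
      using that r(1) \<open>0 < w\<close> mult_left_mono[OF that, of r] by (simp add: c_def abs_mult divide_simps)
    then have "e \<le> - bump'' (c * s)" using r(3)[of "c * s"] by simp
    then have "(A * c\<^sup>2 * \<phi> z) * e \<le> (A * c\<^sup>2 * \<phi> z) * - bump'' (c * s)"
      using A \<open>0 \<le> \<phi> z\<close> by (intro mult_left_mono) auto
    also have "(A * c\<^sup>2 * \<phi> z) * e = \<phi> z / d"
      using r(2) c d(1) by (simp add: A_def)
    finally show ?thesis by (simp add: d2 power2_eq_square mult_ac)
  qed
  show thesis
  proof (rule that[of \<psi>])
    show "test_function (half_plane \<times> UNIV) \<psi>"
    proof (rule test_functionI[OF Ck\<psi>])
      show "compact (S \<times> {- 1 / c .. 1 / c})" by (intro compact_Times S) auto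
      show "S \<times> {- 1 / c .. 1 / c} \<subseteq> half_plane \<times> UNIV" using S by auto
      show "{z. \<psi> z \<noteq> 0} \<subseteq> S \<times> {- 1 / c .. 1 / c}"
      proof
        fix y assume y: "y \<in> {z. \<psi> z \<noteq> 0}"
        then have "\<not> c * snd y + 1 \<le> 0" "\<not> - c * snd y + 1 \<le> 0" "\<phi> (fst y) \<noteq> 0"
          using flat_nonpos_eq_0 by (auto simp: \<psi>_def)
        then show "y \<in> S \<times> {- 1 / c .. 1 / c}"
          using c S(3) by (auto simp: mem_Times_iff field_simps)
      qed
    qed
    show "0 \<le> dir_deriv ((0, 0), 1) (dir_deriv ((0, 0), 1) \<psi>) (z, s)" if "\<bar>s\<bar> \<le> w" for z s
      using order_trans[OF divide_nonneg_pos[OF \<open>0 \<le> \<phi> z\<close> d(1)] low[OF that]]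
      by (simp add: zero_prod_def)
    show "1 \<le> dir_deriv ((0, 0), 1) (dir_deriv ((0, 0), 1) \<psi>) (z, s)" if "z \<in> K" "\<bar>s\<bar> \<le> w" for z s
      using order_trans[OF _ low[OF that(2)], of 1 z] d(1) d(2)[OF that(1)]
      by (simp add: zero_prod_def)
  qed
qed

section \<open>Mass of the entropy kernel and bounds from the invariant region\<close>

lemma open_half_plane: "open half_plane"
  by (simp add: half_plane_def open_Times)

text \<open>The substitution s = u + R x with R = \<rho>^\<theta> / \<theta> gives
  \<open>kernel_const \<theta>\<close> times R^(1 + 2 l) J. The integral J cancels against the
  normalising constant, and since 1 + 2 l = 1/\<theta> the remaining factor \<theta>^(1/\<theta>)
  R^(1/\<theta>) is \<rho>.\<close>

lemma nn_integral_entropy_kernel_le: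
  assumes "0 < \<theta>" "\<theta> < 1" "0 \<le> \<rho>"
  shows "(\<integral>\<^sup>+s. ennreal (entropy_kernel \<theta> \<rho> (s - u)) \<partial>lborel) \<le> ennreal \<rho>"
proof (cases "\<rho> = 0")
  case True
  then have "entropy_kernel \<theta> \<rho> v = 0" for v
    by (simp add: entropy_kernel_def)
  then show ?thesis by simp
next
  case False
  with assms have \<rho>: "0 < \<rho>" by simp
  define l where "l = (1 - \<theta>) / (2 * \<theta>)"
  define R where "R = \<rho> powr \<theta> / \<theta>"
  define J where "J = (LBINT \<tau>=ereal (-1)..ereal 1. (1 - \<tau>\<^sup>2) powr l)"
  have R: "0 < R" using \<rho> assms by (simp add: R_def)
  have l: "0 < l" using assms by (simp add: l_def)
  let ?f = "\<lambda>x::real. max 0 (1 - x\<^sup>2) powr l"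
  \<comment> \<open>The kernel truncates at 0, whereas the integral in \<open>kernel_const\<close>
    runs over an open interval; they agree because \<open>0 powr l = 0\<close>.\<close>
  have f_eq: "?f x = indicator (einterval (ereal (-1)) (ereal 1)) x *\<^sub>R ((1 - x\<^sup>2) powr l)" for x
  proof (cases "\<bar>x\<bar> < 1")
    case True
    then have "x\<^sup>2 < 1" by (simp add: abs_square_less_1)
    with True show ?thesis by (simp add: einterval_def max_def abs_less_iff)
  next
    case False
    then have "\<not> x\<^sup>2 < 1" by (simp add: abs_square_less_1)
    with False show ?thesis by (auto simp: einterval_def max_def indicator_def)
  qed
  have int: "integrable lborel ?f"
  proof (rule integrableI_bounded_set[where A = "{-1..1}" and B = 1])
    show "AE x in lborel. x \<in> {-1..1} \<longrightarrow> norm (?f x) \<le> 1"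
      using l by (auto intro!: powr_le1)
    show "AE x in lborel. x \<notin> {-1..1} \<longrightarrow> ?f x = 0"
    proof (intro AE_I2 impI)
      fix x :: real assume "x \<notin> {-1..1}"
      then have "x \<notin> einterval (ereal (-1)) (ereal 1)" by (auto simp: einterval_def)
      then show "?f x = 0" unfolding f_eq by simp
    qed
  qed auto
  have J: "J = (\<integral>x. ?f x \<partial>lborel)"
    unfolding J_def interval_lebesgue_integral_def set_lebesgue_integral_def f_eq by simp
  have J0: "0 \<le> J" unfolding J by simp
  have kc: "kernel_const \<theta> = \<theta> powr (1 / \<theta>) * inverse J"
    by (simp add: kernel_const_def J_def l_def)
  have scale: "entropy_kernel \<theta> \<rho> (R * x) = kernel_const \<theta> * R powr (2 * l) * ?f x" for x
  proof -
    have "max 0 (R\<^sup>2 - (R * x)\<^sup>2) = R\<^sup>2 * max 0 (1 - x\<^sup>2)"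
      using R by (simp add: max_mult_distrib_left algebra_simps power_mult_distrib)
    moreover have "R\<^sup>2 powr l = R powr (2 * l)"
      using R by (simp add: powr_powr flip: powr_numeral)
    ultimately show ?thesis
      using R by (simp add: entropy_kernel_def R_def[symmetric] l_def[symmetric] powr_mult)
  qed
  have pos: "0 \<le> kernel_const \<theta> * R powr (2 * l)"
    using J0 by (simp add: kc)
  have meas: "(\<lambda>s. ennreal (entropy_kernel \<theta> \<rho> (s - u))) \<in> borel_measurable borel"
    unfolding entropy_kernel_def by measurable
  have "(\<integral>\<^sup>+s. ennreal (entropy_kernel \<theta> \<rho> (s - u)) \<partial>lborel)
      = ennreal R * (\<integral>\<^sup>+x. ennreal (entropy_kernel \<theta> \<rho> (R * x)) \<partial>lborel)"
    using nn_integral_real_affine[OF meas, of R u] R by simp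
  also have "(\<integral>\<^sup>+x. ennreal (entropy_kernel \<theta> \<rho> (R * x)) \<partial>lborel)
      = ennreal (\<integral>x. kernel_const \<theta> * R powr (2 * l) * ?f x \<partial>lborel)"
    unfolding scale using pos int by (intro nn_integral_eq_integral) auto
  also have "(\<integral>x. kernel_const \<theta> * R powr (2 * l) * ?f x \<partial>lborel) = kernel_const \<theta> * R powr (2 * l) * J"
    by (simp add: J)
  also have "ennreal R * ennreal (kernel_const \<theta> * R powr (2 * l) * J)
      = ennreal (R * (kernel_const \<theta> * R powr (2 * l) * J))"
    using R by (simp add: ennreal_mult')
  also have "R * (kernel_const \<theta> * R powr (2 * l) * J)
      = \<theta> powr (1 / \<theta>) * (R powr 1 * R powr (2 * l)) * (inverse J * J)"
    using R by (simp add: kc)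
  also have "R powr 1 * R powr (2 * l) = R powr (1 / \<theta>)"
  proof -
    have "1 + 2 * l = 1 / \<theta>" using assms(1) by (simp add: l_def field_simps)
    then show ?thesis by (metis powr_add)
  qed
  also have "\<theta> powr (1 / \<theta>) * R powr (1 / \<theta>) = \<rho>"
    using assms(1) \<rho> by (simp add: R_def powr_divide powr_powr)
  \<comment> \<open>At J = 0 the product is 0 because \<open>inverse 0 = 0\<close>, so the upper
    bound holds without showing J > 0.\<close>
  also have "\<rho> * (inverse J * J) \<le> \<rho>"
    using \<rho> by (cases "J = 0") auto
  finally show ?thesis
    by (simp add: ennreal_leI)
qed

text \<open>Uniformity in \<theta> comes from ln y <= y - 1 at y = \<rho>^\<theta>, which bounds
  (\<rho>^\<theta> - 1) / \<theta> below by ln \<rho>. Near vacuum |u| may grow like - ln \<rho>,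
  but - \<rho> ln \<rho> <= 1 - \<rho> keeps the momentum bounded.\<close>

lemma density_momentum_bound:
  assumes "0 < \<theta>" "0 \<le> \<rho>" "riemann_bound \<theta> \<rho> m \<le> w" "0 \<le> w" "0 \<le> c"
  shows "\<rho> * (c + \<bar>m / \<rho>\<bar>) \<le> exp w * (c + w) + 1"
proof (cases "\<rho> = 0")
  case True
  then show ?thesis using assms by (simp add: add_nonneg_nonneg)
next
  case False
  with assms have \<rho>: "0 < \<rho>" by simp
  have "\<theta> * ln \<rho> \<le> \<rho> powr \<theta> - 1"
    using ln_le_minus_one[of "\<rho> powr \<theta>"] \<rho> by (simp add: ln_powr)
  then have "ln \<rho> \<le> (\<rho> powr \<theta> - 1) / \<theta>"
    using assms(1) by (simp add: field_simps)
  then have u: "\<bar>m / \<rho>\<bar> \<le> w - ln \<rho>"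
    using assms(3) \<rho> by (simp add: riemann_bound_def)
  then have "ln \<rho> \<le> w" by linarith
  then have \<rho>w: "\<rho> \<le> exp w" using \<rho> by (metis exp_le_cancel_iff exp_ln)
  have "- ln \<rho> \<le> 1 / \<rho> - 1"
    using ln_le_minus_one[of "1 / \<rho>"] \<rho> by (simp add: ln_div)
  then have "\<rho> * - ln \<rho> \<le> \<rho> * (1 / \<rho> - 1)"
    using \<rho> by (intro mult_left_mono) auto
  then have e: "\<rho> * - ln \<rho> \<le> 1" using \<rho> by (simp add: algebra_simps)
  have "\<rho> * (c + \<bar>m / \<rho>\<bar>) \<le> \<rho> * (c + (w - ln \<rho>))"
    using u \<rho> by (intro mult_left_mono) auto
  also have "\<dots> = \<rho> * (c + w) + \<rho> * - ln \<rho>" by (simp add: algebra_simps)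
  also have "\<dots> \<le> exp w * (c + w) + 1"
    using \<rho>w assms e by (intro add_mono mult_right_mono) auto
  finally show ?thesis .
qed

section \<open>The kinetic equation paired with a fixed test function\<close>

definition kinetic_integrand ::
  "real \<Rightarrow> (real \<times> real \<Rightarrow> real) \<Rightarrow> (real \<times> real \<Rightarrow> real) \<Rightarrow> ((real \<times> real) \<times> real \<Rightarrow> real)
    \<Rightarrow> (real \<times> real) \<times> real \<Rightarrow> real" where
  "kinetic_integrand \<theta> \<rho> m \<psi> = (\<lambda>(z, s). entropy_kernel \<theta> (\<rho> z) (s - m z / \<rho> z)
     * (dir_deriv ((1, 0), 0) \<psi> (z, s)
        + (\<theta> * s + (1 - \<theta>) * (m z / \<rho> z)) * dir_deriv ((0, 1), 0) \<psi> (z, s)))"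

text \<open>Pulling the kernel out of both flux terms leaves one bracket to estimate. The minus sign
  from integration by parts cancels the one from \<open>\<mu> = - D\<close>.\<close>

lemma kinetic_equationD:
  assumes "kinetic_equation \<theta> \<rho> m \<mu>" "test_function (half_plane \<times> UNIV) \<psi>"
  shows "integrable kinetic_measure (kinetic_integrand \<theta> \<rho> m \<psi>)"
    and "(LINT y|\<mu>. dir_deriv ((0, 0), 1) (dir_deriv ((0, 0), 1) \<psi>) y)
      = (LINT y|kinetic_measure. kinetic_integrand \<theta> \<rho> m \<psi> y)"
proof -
  have "kinetic_integrand \<theta> \<rho> m \<psi> =
     (\<lambda>y. (case y of (z, s) \<Rightarrow> entropy_kernel \<theta> (\<rho> z) (s - m z / \<rho> z)) * dir_deriv ((1, 0), 0) \<psi> y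
     + (case y of (z, s) \<Rightarrow> (\<theta> * s + (1 - \<theta>) * (m z / \<rho> z))
         * (case (z, s) of (z, s) \<Rightarrow> entropy_kernel \<theta> (\<rho> z) (s - m z / \<rho> z)))
       * dir_deriv ((0, 1), 0) \<psi> y)"
    by (auto simp: kinetic_integrand_def fun_eq_iff algebra_simps)
  with assms show "integrable kinetic_measure (kinetic_integrand \<theta> \<rho> m \<psi>)"
    "(LINT y|\<mu>. dir_deriv ((0, 0), 1) (dir_deriv ((0, 0), 1) \<psi>) y)
      = (LINT y|kinetic_measure. kinetic_integrand \<theta> \<rho> m \<psi> y)"
    unfolding kinetic_equation_def Let_def by auto
qed

lemma dir_deriv_eq_0_outside:
  assumes "y \<notin> closure {z. f z \<noteq> 0}"
  shows "dir_deriv v f y = 0"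
proof -
  have "((\<lambda>z. 0) has_derivative (\<lambda>v. 0)) (at y)" by simp
  then have "(f has_derivative (\<lambda>v. 0)) (at y)"
  proof (rule has_derivative_transform_within_open)
    show "open (- closure {z. f z \<noteq> 0})" "y \<in> - closure {z. f z \<noteq> 0}"
      using assms by auto
    show "0 = f z" if "z \<in> - closure {z. f z \<noteq> 0}" for z
      using that closure_subset[of "{z. f z \<noteq> 0}"] by auto
  qed
  then show ?thesis by (rule dir_deriv_eqI)
qed

lemma continuous_supported_bound:
  fixes f :: "'a::metric_space \<Rightarrow> real"
  assumes "continuous_on UNIV f" "compact S" "\<And>y. y \<notin> S \<Longrightarrow> f y = 0"
  obtains M where "0 \<le> M" "\<And>y. \<bar>f y\<bar> \<le> M"
proof -
  have "bounded (f ` S)"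
    using assms by (meson compact_continuous_image compact_imp_bounded continuous_on_subset top_greatest)
  then obtain M where M: "\<And>y. y \<in> S \<Longrightarrow> \<bar>f y\<bar> \<le> M"
    unfolding bounded_iff by auto
  show thesis
  proof
    show "0 \<le> \<bar>M\<bar>" by simp
    show "\<bar>f y\<bar> \<le> \<bar>M\<bar>" for y
      using M[of y] assms(3)[of y] by (cases "y \<in> S") auto
  qed
qed

lemma test_function_continuous_dir_deriv:
  assumes "test_function \<Omega> \<psi>"
  shows "continuous_on UNIV (dir_deriv v \<psi>)" "continuous_on UNIV (dir_deriv v (dir_deriv v' \<psi>))"
proof -
  have "Ck (Suc (Suc 0)) \<psi>" "Ck (Suc 0) \<psi>" using assms by (auto simp: test_function_def simp del: Ck.simps)
  then show "continuous_on UNIV (dir_deriv v \<psi>)" "continuous_on UNIV (dir_deriv v (dir_deriv v' \<psi>))"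
    unfolding Ck.simps by blast+
qed

lemma entropy_kernel_nonneg: "0 \<le> entropy_kernel \<theta> \<rho> v"
proof -
  have "0 \<le> (LBINT \<tau>=ereal (-1)..ereal 1. (1 - \<tau>\<^sup>2) powr ((1 - \<theta>) / (2 * \<theta>)))"
    unfolding interval_lebesgue_integral_def set_lebesgue_integral_def by simp
  then show ?thesis
    by (simp add: entropy_kernel_def kernel_const_def)
qed

text \<open>On the support of \<psi> both z and s have norm at most N, and there |\<theta> s + (1 -
  \<theta>) u| <= N + |u| for every \<theta> in (0, 1). So M and N depend on \<psi> alone.\<close>

lemma kinetic_integrand_bound:
  assumes "test_function (half_plane \<times> UNIV) \<psi>"
  obtains M N where "0 \<le> M" "0 \<le> N"
    "\<And>\<theta> \<rho> m z s. 0 < \<theta> \<Longrightarrow> \<theta> < 1 \<Longrightarrow> \<bar>kinetic_integrand \<theta> \<rho> m \<psi> (z, s)\<bar>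
      \<le> indicator (cball 0 N) z * (M * (1 + N + \<bar>m z / \<rho> z\<bar>)) * entropy_kernel \<theta> (\<rho> z) (s - m z / \<rho> z)"
proof -
  define S where "S = closure {y. \<psi> y \<noteq> 0}"
  have S: "compact S" using assms by (simp add: test_function_def S_def)
  obtain M1 where M1: "0 \<le> M1" "\<And>y. \<bar>dir_deriv ((1, 0), 0) \<psi> y\<bar> \<le> M1"
    using continuous_supported_bound[OF test_function_continuous_dir_deriv(1)[OF assms] S]
      dir_deriv_eq_0_outside unfolding S_def by blast
  obtain M2 where M2: "0 \<le> M2" "\<And>y. \<bar>dir_deriv ((0, 1), 0) \<psi> y\<bar> \<le> M2"
    using continuous_supported_bound[OF test_function_continuous_dir_deriv(1)[OF assms] S]
      dir_deriv_eq_0_outside unfolding S_def by blast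
  obtain N where N: "0 \<le> N" "\<And>y. y \<in> S \<Longrightarrow> norm y \<le> N"
    using S compact_imp_bounded bounded_pos by (metis less_imp_le)
  show thesis
  proof (rule that[of "M1 + M2" N])
    fix \<theta> :: real and \<rho> m :: "real \<times> real \<Rightarrow> real" and z s
    assume \<theta>: "0 < \<theta>" "\<theta> < 1"
    let ?k = "entropy_kernel \<theta> (\<rho> z) (s - m z / \<rho> z)"
    let ?u = "m z / \<rho> z"
    show "\<bar>kinetic_integrand \<theta> \<rho> m \<psi> (z, s)\<bar>
      \<le> indicator (cball 0 N) z * ((M1 + M2) * (1 + N + \<bar>?u\<bar>)) * ?k"
    proof (cases "(z, s) \<in> S")
      case True
      then have "norm (z, s) \<le> N" by (rule N(2))
      then have z: "z \<in> cball 0 N" and s: "\<bar>s\<bar> \<le> N"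
        using norm_fst_le[of z s] norm_snd_le[of s z] by auto
      have a: "\<bar>\<theta> * s + (1 - \<theta>) * ?u\<bar> \<le> N + \<bar>?u\<bar>"
      proof -
        have "\<bar>\<theta> * s\<bar> \<le> 1 * \<bar>s\<bar>" "\<bar>(1 - \<theta>) * ?u\<bar> \<le> 1 * \<bar>?u\<bar>"
          unfolding abs_mult using \<theta> by (intro mult_right_mono; simp)+
        with s show ?thesis by linarith
      qed
      have "\<bar>dir_deriv ((1, 0), 0) \<psi> (z, s) + (\<theta> * s + (1 - \<theta>) * ?u) * dir_deriv ((0, 1), 0) \<psi> (z, s)\<bar>
          \<le> M1 + (N + \<bar>?u\<bar>) * M2"
        by (rule order_trans[OF abs_triangle_ineq], unfold abs_mult, intro add_mono mult_mono)
           (use M1 M2 a N in auto)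
      also have "\<dots> \<le> (M1 + M2) * (1 + N + \<bar>?u\<bar>)"
      proof -
        have "M1 + (N + U) * M2 \<le> (M1 + M2) * (1 + N + U)" if "0 \<le> U" for U
          using mult_nonneg_nonneg[OF M1(1) N(1)] mult_nonneg_nonneg[OF M1(1) that] M2(1)
          by (simp add: algebra_simps)
        then show ?thesis by simp
      qed
      finally have "\<bar>kinetic_integrand \<theta> \<rho> m \<psi> (z, s)\<bar> \<le> ?k * ((M1 + M2) * (1 + N + \<bar>?u\<bar>))"
        unfolding kinetic_integrand_def prod.case abs_mult abs_of_nonneg[OF entropy_kernel_nonneg]
        by (rule mult_left_mono[OF _ entropy_kernel_nonneg])
      then show ?thesis using z by (simp only: indicator_simps mult_1 mult.commute)
    next
      case False
      then have "kinetic_integrand \<theta> \<rho> m \<psi> (z, s) = 0"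
        by (simp add: kinetic_integrand_def S_def dir_deriv_eq_0_outside)
      then show ?thesis using M1 M2 N entropy_kernel_nonneg by simp
    qed
  qed (use M1 M2 N in auto)
qed

text \<open>Integrating in s first replaces the kernel by at most \<rho>. This factor absorbs the
  growth 1 + N + |u| by \<open>density_momentum_bound\<close> with c = 1 + N, and what remains is a
  constant over a disc.\<close>

lemma kinetic_pairing_bound:
  assumes "test_function (half_plane \<times> UNIV) \<psi>" "0 \<le> w"
  obtains C where "0 < C"
    "\<And>\<theta> \<rho> m. 0 < \<theta> \<Longrightarrow> \<theta> < 1 \<Longrightarrow>
      AE z in half_plane_measure. 0 \<le> \<rho> z \<and> riemann_bound \<theta> (\<rho> z) (m z) \<le> w \<Longrightarrow>
      integrable kinetic_measure (kinetic_integrand \<theta> \<rho> m \<psi>) \<Longrightarrow>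
      (LINT y|kinetic_measure. kinetic_integrand \<theta> \<rho> m \<psi> y) \<le> C"
proof -
  obtain M N where MN: "0 \<le> M" "0 \<le> N" and g:
    "\<And>\<theta> \<rho> m z s. 0 < \<theta> \<Longrightarrow> \<theta> < 1 \<Longrightarrow> \<bar>kinetic_integrand \<theta> \<rho> m \<psi> (z, s)\<bar>
      \<le> indicator (cball 0 N) z * (M * (1 + N + \<bar>m z / \<rho> z\<bar>)) * entropy_kernel \<theta> (\<rho> z) (s - m z / \<rho> z)"
    using kinetic_integrand_bound[OF assms(1)] by metis
  define B where "B = M * (exp w * (1 + N + w) + 1)"
  have B: "0 \<le> B" using MN assms(2) by (simp add: B_def add_nonneg_nonneg)
  define V where "V = measure lborel (cball (0 :: real \<times> real) N)"
  have V: "emeasure lborel (cball (0 :: real \<times> real) N) = ennreal V"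
    unfolding V_def by (rule emeasure_eq_ennreal_measure) (use emeasure_lborel_cball_finite[of "0 :: real \<times> real" N] in simp)
  have "0 \<le> V" by (simp add: V_def)
  show thesis
  \<comment> \<open>The summand 1 only makes the constant positive.\<close>
  proof (rule that[of "B * V + 1"])
    show "0 < B * V + 1" using B \<open>0 \<le> V\<close> by (simp add: add_nonneg_pos)
  next
    fix \<theta> :: real and \<rho> m :: "real \<times> real \<Rightarrow> real"
    assume \<theta>: "0 < \<theta>" "\<theta> < 1"
      and AE: "AE z in half_plane_measure. 0 \<le> \<rho> z \<and> riemann_bound \<theta> (\<rho> z) (m z) \<le> w"
      and int: "integrable kinetic_measure (kinetic_integrand \<theta> \<rho> m \<psi>)"
    let ?g = "kinetic_integrand \<theta> \<rho> m \<psi>"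
    let ?H = "half_plane \<times> (UNIV :: real set)"
    have H: "half_plane \<in> sets borel" "?H \<in> sets borel"
      using open_half_plane by (auto intro!: borel_open open_Times)
    have AE': "AE z in lborel. z \<in> half_plane \<longrightarrow> 0 \<le> \<rho> z \<and> riemann_bound \<theta> (\<rho> z) (m z) \<le> w"
      using AE H unfolding half_plane_measure_def by (subst (asm) AE_restrict_space_iff) auto
    \<comment> \<open>Tonelli needs measurability on the whole product space, while integrability
      gives it over the half plane only; the indicator extends the integrand by 0.\<close>
    have meas: "(\<lambda>y. ennreal \<bar>?g y\<bar> * indicator ?H y) \<in> borel_measurable lborel"
    proof -
      have "(\<lambda>y. ennreal \<bar>?g y\<bar>) \<in> borel_measurable kinetic_measure"
        using borel_measurable_integrable[OF int] by measurable
      then show ?thesis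
        unfolding kinetic_measure_def using H by (subst (asm) borel_measurable_restrict_space_iff_ennreal) auto
    qed
    have inner: "(\<integral>\<^sup>+s. ennreal \<bar>?g (z, s)\<bar> * indicator ?H (z, s) \<partial>lborel)
        \<le> ennreal B * indicator (cball 0 N) z"
      if z: "z \<in> half_plane \<longrightarrow> 0 \<le> \<rho> z \<and> riemann_bound \<theta> (\<rho> z) (m z) \<le> w" for z
    proof (cases "z \<in> half_plane")
      case False
      then show ?thesis by simp
    next
      case True
      let ?c = "indicator (cball 0 N) z * (M * (1 + N + \<bar>m z / \<rho> z\<bar>))"
      have c: "0 \<le> ?c" using MN by simp
      have "(\<integral>\<^sup>+s. ennreal \<bar>?g (z, s)\<bar> * indicator ?H (z, s) \<partial>lborel)
          \<le> (\<integral>\<^sup>+s. ennreal ?c * ennreal (entropy_kernel \<theta> (\<rho> z) (s - m z / \<rho> z)) \<partial>lborel)"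
      proof (rule nn_integral_mono)
        fix s
        have "ennreal \<bar>?g (z, s)\<bar> \<le> ennreal (?c * entropy_kernel \<theta> (\<rho> z) (s - m z / \<rho> z))"
          by (rule ennreal_leI[OF g[OF \<theta>]])
        also have "\<dots> = ennreal ?c * ennreal (entropy_kernel \<theta> (\<rho> z) (s - m z / \<rho> z))"
          by (rule ennreal_mult[OF c entropy_kernel_nonneg])
        finally show "ennreal \<bar>?g (z, s)\<bar> * indicator ?H (z, s)
            \<le> ennreal ?c * ennreal (entropy_kernel \<theta> (\<rho> z) (s - m z / \<rho> z))"
          using True by simp
      qed
      also have "\<dots> = ennreal ?c * (\<integral>\<^sup>+s. ennreal (entropy_kernel \<theta> (\<rho> z) (s - m z / \<rho> z)) \<partial>lborel)"
        by (rule nn_integral_cmult) (simp add: entropy_kernel_def)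
      also have "\<dots> \<le> ennreal ?c * ennreal (\<rho> z)"
        using True z \<theta> by (intro mult_left_mono nn_integral_entropy_kernel_le) auto
      also have "\<dots> = ennreal (?c * \<rho> z)"
        using c by (simp add: ennreal_mult')
      also have "?c * \<rho> z \<le> indicator (cball 0 N) z * B"
      proof -
        have "\<rho> z * ((1 + N) + \<bar>m z / \<rho> z\<bar>) \<le> exp w * ((1 + N) + w) + 1"
          using True z \<theta> assms(2) MN by (intro density_momentum_bound[of \<theta>]) auto
        then have "M * (\<rho> z * (1 + N + \<bar>m z / \<rho> z\<bar>)) \<le> B"
          unfolding B_def using MN by (intro mult_left_mono) auto
        then have "indicator (cball 0 N) z * (M * (\<rho> z * (1 + N + \<bar>m z / \<rho> z\<bar>))) \<le> indicator (cball 0 N) z * B"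
          by (intro mult_left_mono) auto
        then show ?thesis by (simp add: mult_ac)
      qed
      finally show ?thesis
        using B by (simp add: ennreal_leI ennreal_mult' ennreal_indicator mult.commute)
    qed
    have "ennreal \<bar>LINT y|kinetic_measure. ?g y\<bar> \<le> (\<integral>\<^sup>+y. ennreal \<bar>?g y\<bar> \<partial>kinetic_measure)"
      using integral_norm_bound_ennreal[OF int] by simp
    also have "\<dots> = (\<integral>\<^sup>+y. ennreal \<bar>?g y\<bar> * indicator ?H y \<partial>lborel)"
      unfolding kinetic_measure_def using H by (intro nn_integral_restrict_space) auto
    also have "\<dots> = (\<integral>\<^sup>+z. \<integral>\<^sup>+s. ennreal \<bar>?g (z, s)\<bar> * indicator ?H (z, s) \<partial>lborel \<partial>lborel)"
      using lborel.nn_integral_fst[of "\<lambda>y. ennreal \<bar>?g y\<bar> * indicator ?H y" lborel] meas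
      by (simp add: lborel_prod)
    also have "\<dots> \<le> (\<integral>\<^sup>+z. ennreal B * indicator (cball (0 :: real \<times> real) N) z \<partial>lborel)"
    proof (rule nn_integral_mono_AE)
      show "AE z in lborel. (\<integral>\<^sup>+s. ennreal \<bar>?g (z, s)\<bar> * indicator ?H (z, s) \<partial>lborel)
          \<le> ennreal B * indicator (cball 0 N) z"
        using AE' by eventually_elim (rule inner)
    qed
    also have "\<dots> = ennreal B * ennreal V"
      by (simp add: nn_integral_cmult_indicator V)
    also have "\<dots> = ennreal (B * V)"
      using B by (simp add: ennreal_mult')
    finally have "\<bar>LINT y|kinetic_measure. ?g y\<bar> \<le> B * V"
      using B \<open>0 \<le> V\<close> by (simp add: ennreal_le_iff)
    then show "(LINT y|kinetic_measure. ?g y) \<le> B * V + 1" by linarith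
  qed
qed

section \<open>Mass and support of the dissipation measure\<close>

lemma emeasure_le_integral_test_function:
  assumes \<mu>: "neg_of_nonpos_radon \<mu>"
    and supp: "emeasure \<mu> (half_plane \<times> (UNIV - {- w..w})) = 0"
    and K: "compact K" "K \<subseteq> half_plane"
    and f: "continuous_on UNIV f" "compact S" "S \<subseteq> half_plane \<times> UNIV" "\<And>y. y \<notin> S \<Longrightarrow> f y = 0"
    and nonneg: "\<And>z s. \<bar>s\<bar> \<le> w \<Longrightarrow> 0 \<le> f (z, s)"
    and ge1: "\<And>z s. z \<in> K \<Longrightarrow> \<bar>s\<bar> \<le> w \<Longrightarrow> 1 \<le> f (z, s)"
  shows "emeasure \<mu> (K \<times> UNIV) \<le> ennreal (LINT y|\<mu>. f y)"
proof -
  have space: "space \<mu> = half_plane \<times> UNIV"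
    and sets: "sets \<mu> = sets (restrict_space borel (half_plane \<times> UNIV))"
    using \<mu> by (auto simp: neg_of_nonpos_radon_def)
  have H: "half_plane \<times> (UNIV :: real set) \<in> sets borel"
    using open_half_plane by (auto intro!: borel_open open_Times)
  have strip: "P \<times> UNIV \<in> sets \<mu>" "emeasure \<mu> (P \<times> UNIV) < \<infinity>"
    if "compact P" "P \<subseteq> half_plane" for P
  proof -
    have "closed (P \<times> (UNIV :: real set))"
      by (rule closed_Times[OF compact_imp_closed[OF that(1)] closed_UNIV])
    then show "P \<times> UNIV \<in> sets \<mu>"
      using that H by (auto simp: sets sets_restrict_space_iff)
    show "emeasure \<mu> (P \<times> UNIV) < \<infinity>"
      using \<mu> that by (auto simp: neg_of_nonpos_radon_def)
  qed
  have AE: "AE y in \<mu>. \<bar>snd y\<bar> \<le> w"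
  proof (rule AE_I)
    show "{y \<in> space \<mu>. \<not> \<bar>snd y\<bar> \<le> w} \<subseteq> half_plane \<times> (UNIV - {- w..w})"
      by (auto simp: space)
    have "open (half_plane \<times> (UNIV - {- w..w}))"
      using open_half_plane by (intro open_Times open_Diff) auto
    then show "half_plane \<times> (UNIV - {- w..w}) \<in> sets \<mu>"
      using H by (auto simp: sets sets_restrict_space_iff)
  qed (rule supp)
  \<comment> \<open>Finite mass is known on sets P \<times> UNIV with P compact, so S is enlarged to
    the strip over its projection; there the bounded function f is integrable.\<close>
  have P: "compact (fst ` S)" "fst ` S \<subseteq> half_plane"
    using f(2,3) by (auto intro!: compact_continuous_image continuous_on_fst continuous_on_id)
  obtain M where M: "\<And>y. \<bar>f y\<bar> \<le> M"
    using continuous_supported_bound[OF f(1,2,4)] by blast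
  have "f \<in> borel_measurable \<mu>"
    using measurable_cong_sets[OF sets refl] borel_measurable_continuous_onI[OF f(1)]
    by (auto intro: measurable_restrict_space1)
  then have int: "integrable \<mu> f"
  proof (rule integrableI_bounded_set[OF strip(1)[OF P] _ strip(2)[OF P], of f M])
    show "AE y in \<mu>. y \<in> fst ` S \<times> UNIV \<longrightarrow> norm (f y) \<le> M" using M by simp
    show "AE y in \<mu>. y \<notin> fst ` S \<times> UNIV \<longrightarrow> f y = 0"
      using f(4) by (intro AE_I2) (metis imageI mem_Times_iff UNIV_I)
  qed
  have intK: "integrable \<mu> (indicator (K \<times> UNIV) :: _ \<Rightarrow> real)"
    using strip[OF K] by simp
  have "measure \<mu> (K \<times> UNIV) = (LINT y|\<mu>. indicator (K \<times> UNIV) y)"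
    using strip[OF K] by simp
  \<comment> \<open>For |s| <= w, hence \<mu>-almost everywhere, f dominates the indicator of K
    \<times> UNIV; for larger |s| it may be negative.\<close>
  also have "\<dots> \<le> (LINT y|\<mu>. f y)"
  proof (rule integral_mono_AE[OF intK int])
    show "AE y in \<mu>. indicator (K \<times> UNIV) y \<le> f y"
      using AE
    proof eventually_elim
      case (elim y)
      then show ?case
        using nonneg[of "snd y" "fst y"] ge1[of "fst y" "snd y"]
        by (cases y) (auto simp: indicator_def)
    qed
  qed
  finally show ?thesis
    using strip(2)[OF K] by (subst emeasure_eq_ennreal_measure) (auto intro: ennreal_leI)
qed

lemma data_bound_le:
  assumes "\<rho>0 \<in> borel_measurable lborel" "m0 \<in> borel_measurable lborel"
    and "AE x in lborel. riemann_bound \<theta> (\<rho>0 x) (m0 x) \<le> w"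
  shows "data_bound \<theta> \<rho>0 m0 \<le> ereal w"
  unfolding data_bound_def
proof (rule esssup_I)
  show "(\<lambda>y. ereal (riemann_bound \<theta> (\<rho>0 y) (m0 y))) \<in> borel_measurable lborel"
    unfolding riemann_bound_def using assms(1,2) by measurable
  show "AE x in lborel. ereal (riemann_bound \<theta> (\<rho>0 x) (m0 x)) \<le> ereal w"
    using assms(3) by simp
qed

text \<open>The interval grows with its bound, so the complement for w lies inside the null
  complement for W. Monotonicity of \<open>emeasure\<close> requires the larger set to be
  measurable, hence the Borel argument.\<close>

lemma emeasure_outside_interval_eq_0:
  assumes "neg_of_nonpos_radon \<mu>" "W \<le> ereal w"
    and "emeasure \<mu> (half_plane \<times> (UNIV - {s. - W \<le> ereal s \<and> ereal s \<le> W})) = 0"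
  shows "emeasure \<mu> (half_plane \<times> (UNIV - {- w..w})) = 0"
proof -
  have sets: "sets \<mu> = sets (restrict_space borel (half_plane \<times> UNIV))"
    using assms(1) by (auto simp: neg_of_nonpos_radon_def)
  have H: "half_plane \<times> (UNIV :: real set) \<in> sets borel" "half_plane \<in> sets borel"
    using open_half_plane by (auto intro!: borel_open open_Times)
  let ?I = "{s. - W \<le> ereal s \<and> ereal s \<le> W}"
  have "?I \<in> sets borel"
    by measurable
  then have "half_plane \<times> (UNIV - ?I) \<in> sets (borel \<Otimes>\<^sub>M borel)"
    using H by (intro pair_measureI) auto
  then have "half_plane \<times> (UNIV - ?I) \<in> sets borel"
    unfolding borel_prod .
  then have m: "half_plane \<times> (UNIV - ?I) \<in> sets \<mu>"
    using H by (auto simp: sets sets_restrict_space_iff)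
  have sub: "?I \<subseteq> {- w..w}"
  proof
    fix s assume "s \<in> ?I"
    then show "s \<in> {- w..w}"
      \<comment> \<open>W = \<infinity> contradicts \<open>W \<le> ereal w\<close>, and W = -
        \<infinity> makes the interval empty.\<close>
      using assms(2) by (cases W) auto
  qed
  have "emeasure \<mu> (half_plane \<times> (UNIV - {- w..w})) \<le> emeasure \<mu> (half_plane \<times> (UNIV - ?I))"
    using sub by (intro emeasure_mono m) auto
  with assms(3) show ?thesis by simp
qed

text \<open>\<psi> and then C are chosen from K and w before \<theta> and the solution enter; this
  order of choice is the uniformity.\<close>

lemma dissipation_bound:
  assumes K: "compact K" "K \<subseteq> half_plane" and w: "0 < w"
  obtains C where "0 < C"
    "\<And>\<theta> \<rho>0 m0 \<rho> m \<mu>. 0 < \<theta> \<Longrightarrow> \<theta> < 1 \<Longrightarrow> constructed_entropy_solution \<theta> \<rho>0 m0 \<rho> m \<mu> \<Longrightarrow>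
      data_bound \<theta> \<rho>0 m0 \<le> ereal w \<Longrightarrow> emeasure \<mu> (K \<times> UNIV) \<le> ennreal C"
proof -
  obtain \<psi> where \<psi>: "test_function (half_plane \<times> UNIV) \<psi>"
    "\<And>z s. \<bar>s\<bar> \<le> w \<Longrightarrow> 0 \<le> dir_deriv ((0, 0), 1) (dir_deriv ((0, 0), 1) \<psi>) (z, s)"
    "\<And>z s. z \<in> K \<Longrightarrow> \<bar>s\<bar> \<le> w \<Longrightarrow> 1 \<le> dir_deriv ((0, 0), 1) (dir_deriv ((0, 0), 1) \<psi>) (z, s)"
    using test_function_convex_in_velocity[OF assms] by blast
  obtain C where C: "0 < C" "\<And>\<theta> \<rho> m. 0 < \<theta> \<Longrightarrow> \<theta> < 1 \<Longrightarrow>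
      AE z in half_plane_measure. 0 \<le> \<rho> z \<and> riemann_bound \<theta> (\<rho> z) (m z) \<le> w \<Longrightarrow>
      integrable kinetic_measure (kinetic_integrand \<theta> \<rho> m \<psi>) \<Longrightarrow>
      (LINT y|kinetic_measure. kinetic_integrand \<theta> \<rho> m \<psi> y) \<le> C"
    using kinetic_pairing_bound[OF \<psi>(1) less_imp_le[OF w]] by blast
  have S: "compact (closure {y. \<psi> y \<noteq> 0})" "closure {y. \<psi> y \<noteq> 0} \<subseteq> half_plane \<times> UNIV"
    using \<psi>(1) by (auto simp: test_function_def)
  have zero: "dir_deriv v (dir_deriv v' \<psi>) y = 0" if "y \<notin> closure {y. \<psi> y \<noteq> 0}" for v v' y
  proof (rule dir_deriv_eq_0_outside)
    \<comment> \<open>Differentiation does not enlarge the closed support, so the argument for one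
      derivative applies again to the second.\<close>
    have "{y. dir_deriv v' \<psi> y \<noteq> 0} \<subseteq> closure {y. \<psi> y \<noteq> 0}"
      using dir_deriv_eq_0_outside by blast
    then show "y \<notin> closure {y. dir_deriv v' \<psi> y \<noteq> 0}"
      using that closure_minimal[OF _ closed_closure] by blast
  qed
  show thesis
  proof (rule that[OF C(1)])
    fix \<theta> \<rho>0 m0 \<rho> m \<mu>
    assume \<theta>: "0 < \<theta>" "\<theta> < 1" and sol: "constructed_entropy_solution \<theta> \<rho>0 m0 \<rho> m \<mu>"
      and W: "data_bound \<theta> \<rho>0 m0 \<le> ereal w"
    have kin: "kinetic_equation \<theta> \<rho> m \<mu>" and \<mu>: "neg_of_nonpos_radon \<mu>"
      using sol by (auto simp: constructed_entropy_solution_def)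
    have null: "emeasure \<mu> (half_plane \<times> (UNIV - {- w..w})) = 0"
      using sol by (intro emeasure_outside_interval_eq_0[OF \<mu> W]) (simp add: constructed_entropy_solution_def)
    have "AE z in half_plane_measure. 0 \<le> \<rho> z \<and> (\<rho> z = 0 \<longrightarrow> m z = 0)"
      "AE z in half_plane_measure. ereal (riemann_bound \<theta> (\<rho> z) (m z)) \<le> data_bound \<theta> \<rho>0 m0"
      using sol by (simp_all add: constructed_entropy_solution_def entropy_solution_def)
    then have AE: "AE z in half_plane_measure. 0 \<le> \<rho> z \<and> riemann_bound \<theta> (\<rho> z) (m z) \<le> w"
    proof eventually_elim
      case (elim z)
      then have "ereal (riemann_bound \<theta> (\<rho> z) (m z)) \<le> ereal w" using W by order
      with elim show ?case by simp
    qed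
    have "emeasure \<mu> (K \<times> UNIV) \<le> ennreal (LINT y|\<mu>. dir_deriv ((0, 0), 1) (dir_deriv ((0, 0), 1) \<psi>) y)"
      by (rule emeasure_le_integral_test_function[OF \<mu> null K
            test_function_continuous_dir_deriv(2)[OF \<psi>(1)] S zero \<psi>(2,3)])
    also have "\<dots> \<le> ennreal C"
      unfolding kinetic_equationD(2)[OF kin \<psi>(1)]
      by (intro ennreal_leI C(2) \<theta> AE kinetic_equationD(1)[OF kin \<psi>(1)])
    finally show "emeasure \<mu> (K \<times> UNIV) \<le> ennreal C" .
  qed
qed

theorem lemma4p1:
  shows "\<exists>C :: real \<Rightarrow> (real \<times> real) set \<Rightarrow> real.
    \<forall>(\<theta>0::real) (w0::real)
      (\<rho>0 :: real \<Rightarrow> real \<Rightarrow> real) (m0 :: real \<Rightarrow> real \<Rightarrow> real)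
      (\<rho> :: real \<Rightarrow> real \<times> real \<Rightarrow> real) (m :: real \<Rightarrow> real \<times> real \<Rightarrow> real)
      (negD :: real \<Rightarrow> ((real \<times> real) \<times> real) measure).
    0 < \<theta>0 \<and> \<theta>0 < 1 \<and> 0 < w0 \<and>
    (\<forall>\<theta>\<in>{0<..\<theta>0}.
        (AE x in lborel. \<rho>0 \<theta> x \<ge> 0) \<and>
        Linf lborel (\<rho>0 \<theta>) \<and> Linf lborel (\<lambda>x. m0 \<theta> x / \<rho>0 \<theta> x) \<and>
        (AE x in lborel. \<bar>m0 \<theta> x\<bar> / \<rho>0 \<theta> x + ((\<rho>0 \<theta> x) powr \<theta> - 1) / \<theta> \<le> w0) \<and>
        constructed_entropy_solution \<theta> (\<rho>0 \<theta>) (m0 \<theta>) (\<rho> \<theta>) (m \<theta>) (negD \<theta>))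
    \<longrightarrow>
    (\<forall>K. compact K \<and> K \<subseteq> half_plane \<longrightarrow>
        C w0 K > 0 \<and>
        (\<forall>\<theta>\<in>{0<..\<theta>0}. emeasure (negD \<theta>) (K \<times> UNIV) \<le> ennreal (C w0 K))) \<and>
    (\<forall>\<theta>\<in>{0<..\<theta>0}. emeasure (negD \<theta>) (half_plane \<times> (UNIV - {- w0..w0})) = 0)"
proof -
  \<comment> \<open>The bound is uniform over 0 < \<theta> < 1, so the constant can be chosen as a
    function of w and K alone, independent even of \<theta>0.\<close>
  have "\<forall>w K. \<exists>C. 0 < w \<longrightarrow> compact K \<longrightarrow> K \<subseteq> half_plane \<longrightarrow> 0 < C \<and>
    (\<forall>\<theta> \<rho>0 m0 \<rho> m \<mu>. 0 < \<theta> \<longrightarrow> \<theta> < 1 \<longrightarrow> constructed_entropy_solution \<theta> \<rho>0 m0 \<rho> m \<mu> \<longrightarrow>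
      data_bound \<theta> \<rho>0 m0 \<le> ereal w \<longrightarrow> emeasure \<mu> (K \<times> UNIV) \<le> ennreal C)"
    using dissipation_bound by metis
  then obtain C where C: "\<And>w K. 0 < w \<Longrightarrow> compact K \<Longrightarrow> K \<subseteq> half_plane \<Longrightarrow> 0 < C w K"
    "\<And>w K \<theta> \<rho>0 m0 \<rho> m \<mu>. 0 < w \<Longrightarrow> compact K \<Longrightarrow> K \<subseteq> half_plane \<Longrightarrow> 0 < \<theta> \<Longrightarrow> \<theta> < 1 \<Longrightarrow>
      constructed_entropy_solution \<theta> \<rho>0 m0 \<rho> m \<mu> \<Longrightarrow> data_bound \<theta> \<rho>0 m0 \<le> ereal w \<Longrightarrow>
      emeasure \<mu> (K \<times> UNIV) \<le> ennreal (C w K)"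
    by metis
  have data: "data_bound \<theta> \<rho>0 m0 \<le> ereal w"
    if "constructed_entropy_solution \<theta> \<rho>0 m0 \<rho> m \<mu>"
      "AE x in lborel. \<bar>m0 x\<bar> / \<rho>0 x + (\<rho>0 x powr \<theta> - 1) / \<theta> \<le> w" for \<theta> \<rho>0 m0 \<rho> m \<mu> w
    using that
    by (intro data_bound_le)
      (simp_all add: constructed_entropy_solution_def entropy_solution_def Linf_def riemann_bound_def)
  have null: "emeasure \<mu> (half_plane \<times> (UNIV - {- w..w})) = 0"
    if "constructed_entropy_solution \<theta> \<rho>0 m0 \<rho> m \<mu>" "data_bound \<theta> \<rho>0 m0 \<le> ereal w"
    for \<theta> \<rho>0 m0 \<rho> m \<mu> w
    using that by (intro emeasure_outside_interval_eq_0[OF _ that(2)])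
      (simp_all add: constructed_entropy_solution_def)
  show ?thesis
  proof (rule exI[of _ C], intro allI impI, elim conjE)
    fix \<theta>0 w0 :: real and \<rho>0 m0 \<rho> m negD
    assume b: "0 < \<theta>0" "\<theta>0 < 1" "0 < w0" and H: "\<forall>\<theta>\<in>{0<..\<theta>0}.
        (AE x in lborel. 0 \<le> \<rho>0 \<theta> x) \<and>
        Linf lborel (\<rho>0 \<theta>) \<and> Linf lborel (\<lambda>x. m0 \<theta> x / \<rho>0 \<theta> x) \<and>
        (AE x in lborel. \<bar>m0 \<theta> x\<bar> / \<rho>0 \<theta> x + ((\<rho>0 \<theta> x) powr \<theta> - 1) / \<theta> \<le> w0) \<and>
        constructed_entropy_solution \<theta> (\<rho>0 \<theta>) (m0 \<theta>) (\<rho> \<theta>) (m \<theta>) (negD \<theta>)"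
    have \<theta>: "0 < \<theta>" "\<theta> < 1"
        "constructed_entropy_solution \<theta> (\<rho>0 \<theta>) (m0 \<theta>) (\<rho> \<theta>) (m \<theta>) (negD \<theta>)"
        "data_bound \<theta> (\<rho>0 \<theta>) (m0 \<theta>) \<le> ereal w0" if "\<theta> \<in> {0<..\<theta>0}" for \<theta>
      using that b bspec[OF H that] by (auto intro: data)
    show "(\<forall>K. compact K \<and> K \<subseteq> half_plane \<longrightarrow>
        0 < C w0 K \<and>
        (\<forall>\<theta>\<in>{0<..\<theta>0}. emeasure (negD \<theta>) (K \<times> UNIV) \<le> ennreal (C w0 K))) \<and>
      (\<forall>\<theta>\<in>{0<..\<theta>0}. emeasure (negD \<theta>) (half_plane \<times> (UNIV - {- w0..w0})) = 0)"
      using C(1)[OF b(3)] C(2)[OF b(3) _ _ \<theta>] null[OF \<theta>(3,4)] by blast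
  qed
qed

end
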